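(* Let $X,Y$ be finite multisets of positive numbers. If $G=(X,Y)$ then $$o^-(G)=\begin{cases}\mathcal L&\text{if }\Delta(G)>0,\\ \mathcal R&\text{if }\Delta(G)<0,\\ \mathcal N&\text{if }\Delta(G)=0.\end{cases}$$
   Context: Games are finite two-player (Left and Right) partizan game forms $G=\{\mathcal G^L\mid\mathcal G^R\}$, with disjunctive sum $G+H$; $0=\{\cdot\mid\cdot\}$ and $\ast=\{0\mid0\}$. Under misère play a player unable to move on their turn wins. $o^-(G)$ denotes the misère-play outcome class of $G$: $\mathcal L$ (Left wins whoever starts), $\mathcal R$ (Right wins whoever starts), $\mathcal N$ (the player who moves first wins), $\mathcal P$ (the player who moves second wins). Numbers are dyadic rationals, identified with their usual (normal-play canonical) game forms: $0=\{\cdot\mid\cdot\}$; $n=\{n-1\mid\cdot\}$ and $-n=\{\cdot\mid -(n-1)\}$ for positive integers $n$; $\frac{2p+1}{2^q}=\left\{\frac{p}{2^{q-1}}\,\middle|\,\frac{p+1}{2^{q-1}}\right\}$ for integers $p$ and $q\ge 1$. The ordinal sum is $G\!:\!H=\{\mathcal G^L,\,G\!:\!\mathcal H^L\mid \mathcal G^R,\,G\!:\!\mathcal H^R\}$. For finite multisets $X,Y$ of positive numbers, $(X,Y)=\sum_{x\in X}\ast\!:\!x+\sum_{y\in Y}\ast\!:\!(-y)$. The advantage of $G=(X,Y)$ is $\Delta(G)=|X|-|Y|$, cardinalities being counted with multiplicity. *)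

theory Defs
  imports Complex_Main "HOL-Library.FSet" "HOL-Library.Multiset"
begin

section \<open>Game forms and disjunctive sum\<close>

datatype game = Game (lefts: "game fset") (rights: "game fset")

lemma size_lefts [termination_simp]: "H |\<in>| lefts G \<Longrightarrow> size H < size G"
  by (cases G) (auto intro!: le_imp_less_Suc trans_le_add1 order.trans[OF _ member_le_sum])

lemma size_rights [termination_simp]: "H |\<in>| rights G \<Longrightarrow> size H < size G"
  by (cases G) (auto intro!: le_imp_less_Suc trans_le_add2 order.trans[OF _ member_le_sum])

lemmas [fundef_cong] = fimage_cong

instantiation game :: "{zero, plus}"
begin

definition zero_game :: game where
  "0 = Game {||} {||}"

fun plus_game :: "game \<Rightarrow> game \<Rightarrow> game" where
  "plus_game G H =
     Game ((\<lambda>G'. plus_game G' H) |`| lefts G |\<union>| (\<lambda>H'. plus_game G H') |`| lefts H)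
          ((\<lambda>G'. plus_game G' H) |`| rights G |\<union>| (\<lambda>H'. plus_game G H') |`| rights H)"

instance ..

end

declare plus_game.simps [simp del]

text \<open>The monoid laws hold for forms literally, not merely up to equivalence of games; hence
  sums over multisets of forms are available.\<close>

instance game :: comm_monoid_add
proof
  fix G H K :: game
  show "G + H + K = G + (H + K)"
  proof (induction "size G + size H + size K" arbitrary: G H K rule: less_induct)
    case less
    have l: "G' + H + K = G' + (H + K)" if "G' |\<in>| lefts G \<or> G' |\<in>| rights G" for G'
      using that by (intro less) (auto dest: size_lefts size_rights)
    have m: "G + H' + K = G + (H' + K)" if "H' |\<in>| lefts H \<or> H' |\<in>| rights H" for H'
      using that by (intro less) (auto dest: size_lefts size_rights)
    have r: "G + H + K' = G + (H + K')" if "K' |\<in>| lefts K \<or> K' |\<in>| rights K" for K'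
      using that by (intro less) (auto dest: size_lefts size_rights)
    have p: "lefts (A + B) = (\<lambda>A'. A' + B) |`| lefts A |\<union>| (\<lambda>B'. A + B') |`| lefts B"
      "rights (A + B) = (\<lambda>A'. A' + B) |`| rights A |\<union>| (\<lambda>B'. A + B') |`| rights B"
      for A B :: game
      by (subst plus_game.simps, simp)+
    have "lefts (G + H + K) = lefts (G + (H + K))"
      unfolding p fimage_funion fset.map_comp comp_def funion_assoc
      by (intro arg_cong2[of _ _ _ _ "(|\<union>|)"] fimage_cong refl l m r) auto
    moreover have "rights (G + H + K) = rights (G + (H + K))"
      unfolding p fimage_funion fset.map_comp comp_def funion_assoc
      by (intro arg_cong2[of _ _ _ _ "(|\<union>|)"] fimage_cong refl l m r) auto
    ultimately show ?case
      by (rule game.expand[OF conjI])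
  qed
  show "G + H = H + G"
  proof (induction "size G + size H" arbitrary: G H rule: less_induct)
    case less
    have l: "G' + H = H + G'" if "G' |\<in>| lefts G \<or> G' |\<in>| rights G" for G'
      using that by (intro less) (auto dest: size_lefts size_rights)
    have r: "G + H' = H' + G" if "H' |\<in>| lefts H \<or> H' |\<in>| rights H" for H'
      using that by (intro less) (auto dest: size_lefts size_rights)
    have "(\<lambda>G'. G' + H) |`| lefts G = (\<lambda>G'. H + G') |`| lefts G"
      "(\<lambda>G'. G' + H) |`| rights G = (\<lambda>G'. H + G') |`| rights G"
      "(\<lambda>H'. G + H') |`| lefts H = (\<lambda>H'. H' + G) |`| lefts H"
      "(\<lambda>H'. G + H') |`| rights H = (\<lambda>H'. H' + G) |`| rights H"
      by (auto intro!: fimage_cong l r)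
    then show ?case
      by (subst (1 2) plus_game.simps) (simp add: funion_commute)
  qed
  show "0 + G = G"
  proof (induction G)
    case (Game L R)
    have L: "(\<lambda>G'. 0 + G') |`| L = id |`| L"
      by (intro fimage_cong) (simp_all add: Game)
    have R: "(\<lambda>G'. 0 + G') |`| R = id |`| R"
      by (intro fimage_cong) (simp_all add: Game)
    show ?case
      by (subst plus_game.simps)
        (simp add: L[unfolded zero_game_def] R[unfolded zero_game_def] zero_game_def
          fset.map_id)
  qed
qed

definition star :: game where
  "star = Game {|0|} {|0|}"

primrec ordinal_sum :: "game \<Rightarrow> game \<Rightarrow> game" where
  "ordinal_sum G (Game L R) =
     Game (lefts G |\<union>| ordinal_sum G |`| L) (rights G |\<union>| ordinal_sum G |`| R)"


section \<open>Misere play\<close>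

datatype player = Left | Right

fun opponent :: "player \<Rightarrow> player" where
  "opponent Left = Right"
| "opponent Right = Left"

fun moves :: "player \<Rightarrow> game \<Rightarrow> game fset" where
  "moves Left G = lefts G"
| "moves Right G = rights G"

lemma size_moves [termination_simp]: "H |\<in>| moves p G \<Longrightarrow> size H < size G"
  by (cases p) (auto dest: size_lefts size_rights)

text \<open>\<open>wins_first p G\<close>: player \<open>p\<close>, who is on turn at \<open>G\<close>, has a winning strategy under misere
  play. Play is finite and has no draws, so \<open>p\<close> wins when the opponent is on turn iff
  \<open>\<not> wins_first (opponent p) G\<close>.\<close>

fun wins_first :: "player \<Rightarrow> game \<Rightarrow> bool" where
  "wins_first p G \<longleftrightarrow>
     moves p G = {||} \<or> (\<exists>G' |\<in>| moves p G. \<not> wins_first (opponent p) G')"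

declare wins_first.simps [simp del]

abbreviation wins_second :: "player \<Rightarrow> game \<Rightarrow> bool" where
  "wins_second p G \<equiv> \<not> wins_first (opponent p) G"

datatype outcome = \<L> | \<R> | \<N> | \<P>

definition misere_outcome :: "game \<Rightarrow> outcome" where
  "misere_outcome G =
     (if wins_first Left G \<and> wins_second Left G then \<L>
      else if wins_first Right G \<and> wins_second Right G then \<R>
      else if wins_first Left G \<and> wins_first Right G then \<N>
      else \<P>)"

lemma misere_outcome_iff:
  "misere_outcome G = \<L> \<longleftrightarrow> wins_first Left G \<and> wins_second Left G"
  "misere_outcome G = \<R> \<longleftrightarrow> wins_first Right G \<and> wins_second Right G"
  "misere_outcome G = \<N> \<longleftrightarrow> wins_first Left G \<and> wins_first Right G"
  "misere_outcome G = \<P> \<longleftrightarrow> wins_second Left G \<and> wins_second Right G"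
  by (auto simp: misere_outcome_def)


section \<open>Dyadic rationals as game forms\<close>

fun nat_form :: "nat \<Rightarrow> game" where
  "nat_form 0 = 0"
| "nat_form (Suc n) = Game {|nat_form n|} {||}"

fun neg_nat_form :: "nat \<Rightarrow> game" where
  "neg_nat_form 0 = 0"
| "neg_nat_form (Suc n) = Game {||} {|neg_nat_form n|}"

text \<open>\<open>dyadic_form m q\<close> is the form of $m/2^q$; the fraction need not be in lowest terms.\<close>

fun dyadic_form :: "int \<Rightarrow> nat \<Rightarrow> game" where
  "dyadic_form m 0 = (if m \<ge> 0 then nat_form (nat m) else neg_nat_form (nat (- m)))"
| "dyadic_form m (Suc q) =
     (if even m then dyadic_form (m div 2) q
      else Game {|dyadic_form (m div 2) q|} {|dyadic_form (m div 2 + 1) q|})"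

definition dyadic :: "rat set" where
  "dyadic = {of_int m / 2 ^ q | m q. True}"

definition number_form :: "rat \<Rightarrow> game" where
  "number_form x = (THE G. \<exists>m q. x = of_int m / 2 ^ q \<and> G = dyadic_form m q)"

lemma dyadic_form_cancel: "dyadic_form (m * 2 ^ k) (q + k) = dyadic_form m q"
proof (induction k)
  case (Suc k)
  have "m * 2 ^ Suc k = 2 * (m * 2 ^ k)"
    by simp
  then have "dyadic_form (m * 2 ^ Suc k) (q + Suc k) = dyadic_form (m * 2 ^ k) (q + k)"
    by (simp only: add_Suc_right dyadic_form.simps) simp
  with Suc show ?case
    by simp
qed simp

lemma dyadic_form_unique:
  assumes "(of_int m / 2 ^ q :: rat) = of_int n / 2 ^ r"
  shows "dyadic_form m q = dyadic_form n r"
proof -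
  from assms have "(of_int (m * 2 ^ r) :: rat) = of_int (n * 2 ^ q)"
    by (simp add: field_simps)
  then have "m * 2 ^ r = n * 2 ^ q"
    by (simp only: of_int_eq_iff)
  then show ?thesis
    using dyadic_form_cancel[of m r q] dyadic_form_cancel[of n q r] by (simp add: add.commute)
qed

lemma number_form_dyadic: "number_form (of_int m / 2 ^ q) = dyadic_form m q"
  unfolding number_form_def 
  by (rule the_equality) (auto dest: dyadic_form_unique)

lemma number_form_0: "number_form 0 = 0"
  using number_form_dyadic[of 0 0] by simp

lemma number_form_pos:
  assumes "n > 0"
  shows "number_form (of_nat n) = Game {|number_form (of_nat (n - 1))|} {||}"
proof -
  from assms obtain k where n: "n = Suc k"
    by (cases n) auto
  have *: "number_form (of_nat j) = nat_form j" for j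
    using number_form_dyadic[of "int j" 0] by simp
  show ?thesis
    unfolding * by (simp add: n)
qed

lemma number_form_neg:
  assumes "n > 0"
  shows "number_form (- of_nat n) = Game {||} {|number_form (- of_nat (n - 1))|}"
proof -
  from assms obtain k where n: "n = Suc k"
    by (cases n) auto
  have *: "number_form (- of_nat j) = neg_nat_form j" for j
    using number_form_dyadic[of "- int j" 0] by (cases "j = 0") auto
  show ?thesis
    unfolding * by (simp add: n)
qed

lemma number_form_fraction:
  assumes "q \<ge> 1"
  shows "number_form (of_int (2 * p + 1) / 2 ^ q) =
    Game {|number_form (of_int p / 2 ^ (q - 1))|} {|number_form (of_int (p + 1) / 2 ^ (q - 1))|}"
  unfolding number_form_dyadic using assms by (cases q) auto


section \<open>Sums of the games \<open>\<star>:x\<close> and \<open>\<star>:(-y)\<close>\<close>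

definition flower_sum :: "rat multiset \<Rightarrow> rat multiset \<Rightarrow> game" where
  "flower_sum X Y =
     (\<Sum>x\<in>#X. ordinal_sum star (number_form x)) + (\<Sum>y\<in>#Y. ordinal_sum star (number_form (- y)))"

text \<open>The advantage is attached to the presentation $(X, Y)$ rather than to the resulting form.\<close>

definition advantage :: "rat multiset \<Rightarrow> rat multiset \<Rightarrow> int" where
  "advantage X Y = int (size X) - int (size Y)"

end

theory Submission
  imports Defs
begin

text \<open>
  The game \<open>\<star>:x\<close> with \<open>x > 0\<close> is worth a whole move to Left because only Left can
  turn it into \<open>\<star>\<close>: its Left options are \<open>0\<close>, \<open>\<star>\<close> and games of the same kind, whereas its Right
  options are \<open>0\<close> and games of the same kind. This, together with the fact that Left always has
  a nonzero option, is all that is used; the predicate \<open>flower\<close> isolates it, for either player,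
  and \<open>flower_ordinal_sum_star\<close> verifies it for numbers. The two players are treated
  symmetrically throughout by speaking of a player \<open>p\<close> and the opponent of \<open>p\<close>.

  Play from a sum of flowers creates stars, and so the induction has to be about sums of \<open>a\<close>
  flowers of \<open>p\<close>, \<open>b\<close> flowers of the opponent and \<open>k\<close> stars. In general their outcome depends on
  more than \<open>a\<close>, \<open>b\<close> and \<open>k\<close>: if \<open>a = b > 0\<close> and \<open>k\<close> is odd, the tempo moves inside the numbers
  matter. The induction (\<open>garden_wins\<close>) therefore proves only sufficient conditions for \<open>p\<close> to win.
  \<^item> Moving first, \<open>p\<close> wins if \<open>a > b\<close>, or if \<open>a = b\<close> and \<open>k\<close> is even.
  \<^item> Moving second, \<open>p\<close> wins if \<open>a \<ge> b + 2\<close>, or if \<open>a = b + 1\<close> and \<open>k\<close> is even, or if there are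
    only stars and \<open>k\<close> is odd.

  On turn in a position of the first list, \<open>p\<close> deletes an opposing flower while there is one;
  after that, with several flowers left, \<open>p\<close> hands over an even number of stars by deleting a star
  if \<open>k\<close> is odd and a flower of \<open>p\<close> if \<open>k\<close> is even. The critical case
  is a single flower of \<open>p\<close> with an even number of stars. There \<open>p\<close> moves inside the flower
  without deleting it: either the position stays of that shape, or the flower becomes a star and
  the number of stars becomes odd, which is a loss for the player on turn. For \<open>k = 0\<close> the
  conditions, applied to both players, decide the outcome in all cases.
\<close>

section \<open>Options of sums\<close>

lemma moves_plus:
  "moves q (G + H) = (\<lambda>G'. G' + H) |`| moves q G |\<union>| (\<lambda>H'. G + H') |`| moves q H"
  by (cases q) (subst plus_game.simps, simp)+

lemma moves_plus_leftI: "G' |\<in>| moves q G \<Longrightarrow> G' + H |\<in>| moves q (G + H)"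
  by (simp add: moves_plus)

lemma moves_plusE:
  assumes "K |\<in>| moves q (G + H)"
  obtains G' where "G' |\<in>| moves q G" "K = G' + H"
  | H' where "H' |\<in>| moves q H" "K = G + H'"
  using assms by (auto simp: moves_plus)

lemma moves_zero [simp]: "moves q 0 = {||}"
  by (cases q) (simp_all add: zero_game_def)

lemma moves_star [simp]: "moves q star = {|0|}"
  by (cases q) (simp_all add: star_def)

lemma moves_sum_msetE:
  assumes "K |\<in>| moves q (\<Sum>\<^sub># M)"
  obtains H H' N where "M = add_mset H N" "H' |\<in>| moves q H" "K = H' + \<Sum>\<^sub># N"
proof -
  have "\<exists>H H' N. M = add_mset H N \<and> H' |\<in>| moves q H \<and> K = H' + \<Sum>\<^sub># N"
    using assms
  proof (induction M arbitrary: K)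
    case (add H M)
    from add.prems have "K |\<in>| moves q (H + \<Sum>\<^sub># M)"
      by simp
    then show ?case
    proof (cases rule: moves_plusE)
      case (2 K')
      with add.IH obtain J J' N where
        "M = add_mset J N" "J' |\<in>| moves q J" "K' = J' + \<Sum>\<^sub># N"
        by blast
      with 2 show ?thesis
        by (intro exI[of _ J] exI[of _ J'] exI[of _ "add_mset H N"]) (simp add: ac_simps)
    qed blast
  qed simp
  with that show thesis
    by blast
qed

section \<open>Flowers\<close>

text \<open>The clause on a nonzero option of \<open>p\<close> provides the waiting move that \<open>p\<close> needs with a
  single remaining flower. The class is closed under the moves that do not destroy a flower, which is
  why it is inductive.\<close>

inductive flower :: "player \<Rightarrow> game \<Rightarrow> bool" for p where
  flowerI: "flower p H"
  if "\<And>q. 0 |\<in>| moves q H"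
    and "\<exists>H' |\<in>| moves p H. H' \<noteq> 0"
    and "\<And>H'. H' |\<in>| moves p H \<Longrightarrow> H' = 0 \<or> H' = star \<or> flower p H'"
    and "\<And>H'. H' |\<in>| moves (opponent p) H \<Longrightarrow> H' = 0 \<or> flower p H'"

lemma opponent_opponent [simp]: "opponent (opponent p) = p"
  by (cases p) auto

lemma ordinal_sum_star_zero [simp]: "ordinal_sum star 0 = star"
  by (simp add: zero_game_def star_def)

lemma moves_ordinal_sum_star:
  "moves q (ordinal_sum star G) = finsert 0 (ordinal_sum star |`| moves q G)"
  by (cases q; cases G) (simp_all add: star_def)

declare ordinal_sum.simps [simp del]

lemma ordinal_sum_star_nonzero: "ordinal_sum star G \<noteq> 0"
proof
  assume "ordinal_sum star G = 0"
  then have "moves Left (ordinal_sum star G) = {||}"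
    by simp
  then show False
    by (simp add: moves_ordinal_sum_star)
qed

text \<open>The hypotheses are what the form of a nonzero number offers to the player \<open>p\<close> on whose side
  of \<open>0\<close> it lies: \<open>p\<close> has an option, which is \<open>0\<close> or lies on the same side, and every option of the
  opponent lies strictly on the same side.\<close>

lemma flower_ordinal_sum_starI:
  assumes "moves p G \<noteq> {||}"
    and "\<And>G'. G' |\<in>| moves p G \<Longrightarrow> G' = 0 \<or> flower p (ordinal_sum star G')"
    and "\<And>G'. G' |\<in>| moves (opponent p) G \<Longrightarrow> flower p (ordinal_sum star G')"
  shows "flower p (ordinal_sum star G)"
  by (rule flowerI)
    (use assms ordinal_sum_star_nonzero in \<open>fastforce simp: moves_ordinal_sum_star\<close>)+

lemma flower_nat_form: "n > 0 \<Longrightarrow> flower Left (ordinal_sum star (nat_form n))"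
proof (induction n)
  case (Suc n)
  then have "nat_form n = 0 \<or> flower Left (ordinal_sum star (nat_form n))"
    by (cases n) simp_all
  then show ?case
    by simp (rule flower_ordinal_sum_starI; auto)
qed simp

lemma flower_neg_nat_form: "n > 0 \<Longrightarrow> flower Right (ordinal_sum star (neg_nat_form n))"
proof (induction n)
  case (Suc n)
  then have "neg_nat_form n = 0 \<or> flower Right (ordinal_sum star (neg_nat_form n))"
    by (cases n) simp_all
  then show ?case
    by simp (rule flower_ordinal_sum_starI; auto)
qed simp

lemma dyadic_form_zero: "dyadic_form 0 q = 0"
  by (induction q) auto

text \<open>The options of the form for an odd numerator \<open>m\<close> have the numerators \<open>m div 2\<close> and
  \<open>m div 2 + 1\<close>. Neither has the sign opposite to that of \<open>m\<close>, and only the one nearer to \<open>0\<close> can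
  vanish; it belongs to the player on whose side \<open>m\<close> lies.\<close>

lemma flower_dyadic_form:
  "m > 0 \<Longrightarrow> flower Left (ordinal_sum star (dyadic_form m q))"
  "m < 0 \<Longrightarrow> flower Right (ordinal_sum star (dyadic_form m q))"
proof (induction q arbitrary: m)
  case 0
  {
    case 1
    then show ?case by (simp add: flower_nat_form)
  next
    case 2
    then show ?case by (simp add: flower_neg_nat_form)
  }
next
  case (Suc q)
  {
    case 1
    show ?case
    proof (cases "even m")
      case True
      with 1 have "m div 2 > 0" by presburger
      with True Suc.IH(1) show ?thesis by simp
    next
      case False
      with 1 have "m div 2 = 0 \<or> m div 2 > 0" "m div 2 + 1 > 0" by presburger+
      with Suc.IH(1) have "dyadic_form (m div 2) q = 0 \<or>
          flower Left (ordinal_sum star (dyadic_form (m div 2) q))"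
        "flower Left (ordinal_sum star (dyadic_form (m div 2 + 1) q))"
        by (metis dyadic_form_zero, blast)
      with False show ?thesis
        by simp (rule flower_ordinal_sum_starI; auto)
    qed
  next
    case 2
    show ?case
    proof (cases "even m")
      case True
      with 2 have "m div 2 < 0" by presburger
      with True Suc.IH(2) show ?thesis by simp
    next
      case False
      with 2 have "m div 2 + 1 = 0 \<or> m div 2 + 1 < 0" "m div 2 < 0" by presburger+
      with Suc.IH(2) have "dyadic_form (m div 2 + 1) q = 0 \<or>
          flower Right (ordinal_sum star (dyadic_form (m div 2 + 1) q))"
        "flower Right (ordinal_sum star (dyadic_form (m div 2) q))"
        by (metis dyadic_form_zero, blast)
      with False show ?thesis
        by simp (rule flower_ordinal_sum_starI; auto)
    qed
  }
qed

lemma flower_ordinal_sum_star: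
  assumes "x \<in> dyadic" "x > 0"
  shows "flower Left (ordinal_sum star (number_form x))"
    and "flower Right (ordinal_sum star (number_form (- x)))"
proof -
  from assms(1) obtain m q where x: "x = of_int m / 2 ^ q"
    by (auto simp: dyadic_def)
  with assms(2) have "m > 0"
    by (simp add: zero_less_divide_iff)
  moreover have "- x = of_int (- m) / 2 ^ q"
    by (simp add: x)
  ultimately show "flower Left (ordinal_sum star (number_form x))"
    and "flower Right (ordinal_sum star (number_form (- x)))"
    using x number_form_dyadic[of m q] number_form_dyadic[of "- m" q]
      flower_dyadic_form(1)[of m q] flower_dyadic_form(2)[of "- m" q] by simp_all
qed

section \<open>Gardens\<close>

text \<open>The numbers \<open>a\<close>, \<open>b\<close>, \<open>k\<close> belong to a presentation of \<open>G\<close> as a sum, not to \<open>G\<close> itself: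
  every move is described as a change of one presentation into another.\<close>

definition garden :: "player \<Rightarrow> nat \<Rightarrow> nat \<Rightarrow> nat \<Rightarrow> game \<Rightarrow> bool" where
  "garden p a b k G \<longleftrightarrow>
     (\<exists>A B. G = \<Sum>\<^sub># A + \<Sum>\<^sub># B + \<Sum>\<^sub># (replicate_mset k star) \<and>
        (\<forall>H\<in>#A. flower p H) \<and> (\<forall>H\<in>#B. flower (opponent p) H) \<and> size A = a \<and> size B = b)"

lemma gardenE:
  assumes "garden p a b k G"
  obtains A B where "G = \<Sum>\<^sub># A + \<Sum>\<^sub># B + \<Sum>\<^sub># (replicate_mset k star)"
    "\<forall>H\<in>#A. flower p H" "\<forall>H\<in>#B. flower (opponent p) H" "size A = a" "size B = b"
  using assms unfolding garden_def by blast

lemma garden_commute: "garden (opponent p) b a k G \<longleftrightarrow> garden p a b k G"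
  unfolding garden_def opponent_opponent by (metis add.commute)

lemma garden_add_flower:
  assumes "garden p a b k G" "flower p H"
  shows "garden p (Suc a) b k (H + G)"
  using assms(1)
proof (rule gardenE)
  fix A B
  assume "G = \<Sum>\<^sub># A + \<Sum>\<^sub># B + \<Sum>\<^sub># (replicate_mset k star)"
    "\<forall>H\<in>#A. flower p H" "\<forall>H\<in>#B. flower (opponent p) H" "size A = a" "size B = b"
  with assms(2) show ?thesis
    unfolding garden_def
    by (intro exI[of _ "add_mset H A"] exI[of _ B]) (auto simp: ac_simps)
qed

lemma garden_add_opposing_flower:
  assumes "garden p a b k G" "flower (opponent p) H"
  shows "garden p a (Suc b) k (H + G)"
  using garden_add_flower[of "opponent p" b a k G H] assms by (simp add: garden_commute)

lemma garden_add_star: "garden p a b k G \<Longrightarrow> garden p a b (Suc k) (star + G)"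
  unfolding garden_def by (auto simp: ac_simps)

lemma garden_remove_flower:
  assumes "garden p (Suc a) b k G"
  obtains H G' where "G = H + G'" "flower p H" "garden p a b k G'"
  using assms
proof (rule gardenE)
  fix A B
  assume *: "G = \<Sum>\<^sub># A + \<Sum>\<^sub># B + \<Sum>\<^sub># (replicate_mset k star)"
    "\<forall>H\<in>#A. flower p H" "\<forall>H\<in>#B. flower (opponent p) H" "size A = Suc a" "size B = b"
  then obtain H A' where A: "A = add_mset H A'"
    by (metis size_eq_Suc_imp_eq_union)
  show thesis
    by (rule that[of H "\<Sum>\<^sub># A' + \<Sum>\<^sub># B + \<Sum>\<^sub># (replicate_mset k star)"])
      (use * A in \<open>auto simp: garden_def ac_simps\<close>)
qed

lemma garden_remove_star:
  assumes "garden p a b (Suc k) G"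
  obtains G' where "G = star + G'" "garden p a b k G'"
  using assms
proof (rule gardenE)
  fix A B
  assume *: "G = \<Sum>\<^sub># A + \<Sum>\<^sub># B + \<Sum>\<^sub># (replicate_mset (Suc k) star)"
    "\<forall>H\<in>#A. flower p H" "\<forall>H\<in>#B. flower (opponent p) H" "size A = a" "size B = b"
  show thesis
    by (rule that[of "\<Sum>\<^sub># A + \<Sum>\<^sub># B + \<Sum>\<^sub># (replicate_mset k star)"])
      (use * in \<open>auto simp: garden_def ac_simps\<close>)
qed

lemma delete_flower:
  assumes "garden p (Suc a) b k G"
  obtains G' where "G' |\<in>| moves q G" "garden p a b k G'"
proof -
  from assms obtain H K where K: "G = H + K" "flower p H" "garden p a b k K"
    by (rule garden_remove_flower)
  from K(2) have "0 |\<in>| moves q H"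
    by cases
  with K(1) have "K |\<in>| moves q G"
    using moves_plus_leftI[of 0 q H K] by simp
  with K(3) that show thesis
    by blast
qed

lemma delete_opposing_flower:
  assumes "garden p a (Suc b) k G"
  obtains G' where "G' |\<in>| moves q G" "garden p a b k G'"
  using assms delete_flower[of "opponent p" b a k G] by (metis garden_commute)

lemma delete_star:
  assumes "garden p a b (Suc k) G"
  obtains G' where "G' |\<in>| moves q G" "garden p a b k G'"
proof -
  from assms obtain K where K: "G = star + K" "garden p a b k K"
    by (rule garden_remove_star)
  from K(1) have "K |\<in>| moves q G"
    using moves_plus_leftI[of 0 q star K] by simp
  with K(2) that show thesis
    by blast
qed

text \<open>This is the waiting move: \<open>p\<close> plays without deleting anything, at worst at the cost of
  exchanging a flower for a star.\<close>

lemma move_in_flower: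
  assumes "garden p (Suc a) b k G"
  obtains G' where "G' |\<in>| moves p G" "garden p (Suc a) b k G' \<or> garden p a b (Suc k) G'"
proof -
  from assms obtain H K where K: "G = H + K" "flower p H" "garden p a b k K"
    by (rule garden_remove_flower)
  from K(2) obtain H' where "H' |\<in>| moves p H" "H' = star \<or> flower p H'"
    by cases blast
  with K that show thesis
    by (meson garden_add_flower garden_add_star moves_plus_leftI)
qed

text \<open>The opponent of \<open>p\<close> cannot turn a flower of \<open>p\<close> into a star. Hence no move of the opponent
  changes both the number of flowers of \<open>p\<close> and the number of stars. Only a move inside a flower leaves
  all three numbers unchanged.\<close>

lemma opponent_move_cases:
  assumes "garden p a b k G" "G' |\<in>| moves (opponent p) G"
  shows "(0 < a + b \<and> garden p a b k G') \<or>
    (\<exists>a'. a = Suc a' \<and> garden p a' b k G') \<or>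
    (\<exists>b'. b = Suc b' \<and> (garden p a b' k G' \<or> garden p a b' (Suc k) G')) \<or>
    (\<exists>k'. k = Suc k' \<and> garden p a b k' G')"
  using assms(1)
proof (rule gardenE)
  fix A B
  let ?S = "\<Sum>\<^sub># (replicate_mset k star)"
  assume G: "G = \<Sum>\<^sub># A + \<Sum>\<^sub># B + ?S"
    and A: "\<forall>H\<in>#A. flower p H" and B: "\<forall>H\<in>#B. flower (opponent p) H"
    and size: "size A = a" "size B = b"
  from assms(2) have "G' |\<in>| moves (opponent p) (\<Sum>\<^sub># (A + B + replicate_mset k star))"
    by (simp add: G)
  then obtain H H' N where N: "A + B + replicate_mset k star = add_mset H N"
    and H': "H' |\<in>| moves (opponent p) H" and G': "G' = H' + \<Sum>\<^sub># N"
    by (rule moves_sum_msetE)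
  from N have "H \<in># A \<or> H \<in># B \<or> H \<in># replicate_mset k star"
    by (metis union_iff union_single_eq_member)
  then consider (own) "H \<in># A" | (opposing) "H \<in># B" | (star) "H \<in># replicate_mset k star"
    by blast
  then show ?thesis
  proof cases
    case own
    then obtain A' where A': "A = add_mset H A'"
      by (metis mset_add)
    with N have "N = A' + B + replicate_mset k star"
      by simp
    with A A' B size have rest: "garden p (size A') b k (\<Sum>\<^sub># N)"
      by (auto simp: garden_def)
    from A A' have "flower p H"
      by simp
    then have "H' = 0 \<or> flower p H'"
      by cases (use H' in blast)
    with rest garden_add_flower[OF rest] show ?thesis
      using size A' by (auto simp: G')
  next
    case opposing
    then obtain B' where B': "B = add_mset H B'"
      by (metis mset_add)
    with N have "N = A + B' + replicate_mset k star"
      by simp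
    with A B' B size have rest: "garden p a (size B') k (\<Sum>\<^sub># N)"
      by (auto simp: garden_def)
    from B B' have "flower (opponent p) H"
      by simp
    then have "H' = 0 \<or> H' = star \<or> flower (opponent p) H'"
      by cases (use H' in blast)
    with rest garden_add_opposing_flower[OF rest] garden_add_star[OF rest] show ?thesis
      using size B' by (auto simp: G')
  next
    case star
    then obtain k' where k': "k = Suc k'" and "H = star"
      by (cases k) (auto split: if_splits)
    with N have "N = A + B + replicate_mset k' star"
      by simp
    moreover from H' \<open>H = star\<close> have "H' = 0"
      by simp
    ultimately have "garden p a b k' G'"
      using A B size by (auto simp: garden_def G')
    with k' show ?thesis
      by blast
  qed
qed

section \<open>Winning strategies\<close>

lemma wins_firstI:
  "G' |\<in>| moves p G \<Longrightarrow> \<not> wins_first (opponent p) G' \<Longrightarrow> wins_first p G"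
  by (subst wins_first.simps) blast

lemma wins_secondI:
  assumes "G' |\<in>| moves (opponent p) G"
    and "\<And>G'. G' |\<in>| moves (opponent p) G \<Longrightarrow> wins_first p G'"
  shows "wins_second p G"
  using assms by (subst wins_first.simps) auto

text \<open>The two parts need each other. For moving second, an even \<open>k\<close> matters when \<open>a = b + 1\<close>
  because the opponent may delete a flower of \<open>p\<close>; the remaining position with \<open>a = b\<close> is covered
  by the first part only for an even number of stars. When the opponent instead changes the parity
  of \<open>k\<close>, there are still more flowers of \<open>p\<close> than of the opponent.\<close>

lemma garden_wins:
  assumes "garden p a b k G"
  shows "a > b \<or> (a = b \<and> even k) \<Longrightarrow> wins_first p G"
    and "a \<ge> b + 2 \<or> (a = b + 1 \<and> even k) \<or> (a = 0 \<and> b = 0 \<and> odd k) \<Longrightarrow> wins_second p G"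
  using assms
proof (induction "size G" arbitrary: G a b k rule: less_induct)
  case less
  let ?good_first = "\<lambda>a b k :: nat. a > b \<or> (a = b \<and> even k)"
  let ?good_second = "\<lambda>a b k :: nat.
    a \<ge> b + 2 \<or> (a = b + 1 \<and> even k) \<or> (a = 0 \<and> b = 0 \<and> odd k)"
  {
    case 1
    have win: ?case
      if "G' |\<in>| moves p G" "garden p a' b' k' G'" "?good_second a' b' k'" for G' a' b' k'
      using less.hyps(2)[OF size_moves[OF that(1)] that(3,2)] that(1) by (rule wins_firstI[rotated])
    \<comment> \<open>Deleting an opposing flower raises \<open>a - b\<close> by one and so turns each favourable case for
      moving first into one for moving second. Only gardens with \<open>b = 0\<close> need other moves, and there
      the aim is an even number of stars while \<open>p\<close> has flowers, and an odd number otherwise.\<close>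
    consider (empty) "a = 0" "b = 0" "k = 0"
      | (opposing) b' where "b = Suc b'"
      | (star) k' where "b = 0" "k = Suc k'" "a = 0 \<or> odd k"
      | (single) "a = Suc 0" "b = 0" "even k"
      | (many) a' where "a = Suc (Suc a')" "b = 0" "even k"
      by (cases a; cases "a - 1"; cases b; cases k) auto
    then show ?case
    proof cases
      case empty
      with 1(2) have "G = 0"
        by (simp add: garden_def)
      then show ?thesis
        by (subst wins_first.simps) simp
    next
      case opposing
      with 1(2) obtain G' where "G' |\<in>| moves p G" "garden p a b' k G'"
        by (blast elim: delete_opposing_flower)
      then show ?thesis
        by (rule win) (use opposing 1(1) in auto)
    next
      case star
      with 1(2) obtain G' where "G' |\<in>| moves p G" "garden p a b k' G'"
        by (blast elim: delete_star)
      then show ?thesis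
        by (rule win) (use star 1(1) in auto)
    next
      case single
      with 1(2) obtain G' where
        "G' |\<in>| moves p G" "garden p (Suc 0) 0 k G' \<or> garden p 0 0 (Suc k) G'"
        by (blast elim: move_in_flower)
      with win[of G' "Suc 0" 0 k] win[of G' 0 0 "Suc k"] single show ?thesis
        by auto
    next
      case many
      with 1(2) obtain G' where "G' |\<in>| moves p G" "garden p (Suc a') b k G'"
        by (metis delete_flower)
      then show ?thesis
        by (rule win) (use many in auto)
    qed
  next
    case 2
    show ?case
    proof -
      from 2(1) consider a' where "a = Suc a'" | k' where "k = Suc k'"
        by (cases a; cases k) auto
      then obtain G' where "G' |\<in>| moves (opponent p) G"
        by cases (metis 2(2) delete_flower, metis 2(2) delete_star)
      then show ?thesis
      proof (rule wins_secondI)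
        fix G'
        assume move: "G' |\<in>| moves (opponent p) G"
        from opponent_move_cases[OF 2(2) this] 2(1)
        obtain a' b' k' where "garden p a' b' k' G'" "?good_first a' b' k'"
          by fastforce
        with less.hyps(1)[OF size_moves[OF move]] show "wins_first p G'"
          by blast
      qed
    qed
  }
qed

lemma garden_flower_sum:
  assumes "\<forall>x\<in>#X. x \<in> dyadic \<and> x > 0" and "\<forall>y\<in>#Y. y \<in> dyadic \<and> y > 0"
  shows "garden Left (size X) (size Y) 0 (flower_sum X Y)"
  unfolding garden_def flower_sum_def
  by (intro exI[of _ "image_mset (\<lambda>x. ordinal_sum star (number_form x)) X"]
      exI[of _ "image_mset (\<lambda>y. ordinal_sum star (number_form (- y))) Y"])
    (use assms in \<open>auto simp: flower_ordinal_sum_star\<close>)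

theorem theorem3p2:
  fixes X Y :: "rat multiset" and G :: game
  assumes "\<forall>x\<in>#X. x \<in> dyadic \<and> x > 0"
    and "\<forall>y\<in>#Y. y \<in> dyadic \<and> y > 0"
    and "G = flower_sum X Y"
  shows "misere_outcome G =
    (if advantage X Y > 0 then \<L>
     else if advantage X Y < 0 then \<R>
     else \<N>)"
proof -
  have L: "garden Left (size X) (size Y) 0 G"
    using garden_flower_sum[OF assms(1,2)] assms(3) by simp
  then have R: "garden Right (size Y) (size X) 0 G"
    using garden_commute[of Left] by simp
  consider "size X > size Y" | "size X < size Y" | "size X = size Y"
    by linarith
  then show ?thesis
  proof cases
    case 1
    then have "size X \<ge> size Y + 2 \<or> size X = size Y + 1"
      by linarith
    with 1 garden_wins[OF L] show ?thesis
      by (auto simp: advantage_def misere_outcome_iff)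
  next
    case 2
    then have "size Y \<ge> size X + 2 \<or> size Y = size X + 1"
      by linarith
    with 2 garden_wins[OF R] show ?thesis
      by (auto simp: advantage_def misere_outcome_iff)
  next
    case 3
    with garden_wins(1)[OF L] garden_wins(1)[OF R] show ?thesis
      by (auto simp: advantage_def misere_outcome_iff)
  qed
qed

end
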